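(* Let $\alpha,\beta>0$ be real numbers with $\alpha\beta=2\pi$. Then $$\sqrt{2}\int_0^\infty \int_0^\infty\frac{\cos 2xy}{\cosh \alpha x\,\cosh\beta y}\,e^{-x^2-y^2}\,dx\,dy=\left(\int_0^\infty\frac{\cosh \frac{\alpha x}{2}}{\cosh \alpha x}\,e^{-x^2}\,dx\right)\left( \int_0^\infty\frac{\cosh \frac{\beta y}{2}}{\cosh \beta y}\,e^{-y^2}\,dy\right).$$ *)

theory Defs
  imports "HOL-Analysis.Analysis"
begin

end

(*
  Since sech is its own Fourier transform, writing 1 / cosh(\<beta> y) as a cosine integral of
  1 / cosh(\<alpha> s / 2) and carrying out the Gaussian integral in y turns the double integral L over the
  plane into \<alpha> / (2 sqrt pi) times the integral of
      exp(- x^2 - w^2) / (cosh(\<alpha> x) cosh(\<alpha> (x - w) / 2)).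
  Symmetrising under x <-> w and then under w -> -w separates this kernel, so that
  L = \<alpha> / (2 sqrt pi) G(\<alpha>)^2, where G(a) is the integral of cosh(a x / 2) / cosh(a x) exp(- x^2) over
  the line. As L is symmetric in \<alpha> and \<beta>, also L = \<beta> / (2 sqrt pi) G(\<beta>)^2; the geometric mean of
  the two expressions is the claim.
*)
theory Submission
  imports Defs "HOL-Complex_Analysis.Complex_Analysis" "HOL-Probability.Probability"
    "HOL-Real_Asymp.Real_Asymp"
begin

section \<open>Decay of sech on the real line\<close>

lemma inverse_cosh_le: "1 / cosh x \<le> 4 * inverse (1 + x\<^sup>2)" for x :: real
proof -
  have "1 + \<bar>x\<bar> + \<bar>x\<bar>\<^sup>2 / 2 \<le> exp \<bar>x\<bar>"
    by (rule exp_lower_Taylor_quadratic) simp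
  moreover have "1 - \<bar>x\<bar> \<le> exp (- \<bar>x\<bar>)"
    using exp_ge_add_one_self[of "- \<bar>x\<bar>"] by simp
  moreover have "cosh x = (exp \<bar>x\<bar> + exp (- \<bar>x\<bar>)) / 2"
    by (simp add: cosh_field_def abs_if)
  \<comment> \<open>The linear terms of the two exponential bounds cancel, leaving
    \<open>cosh x\<close> at least \<open>1 + x\<^sup>2 / 4\<close>.\<close>
  ultimately have "(1 + x\<^sup>2) / 4 \<le> cosh x"
    by simp
  moreover have "1 + x\<^sup>2 > 0"
    by (simp add: add_pos_nonneg)
  ultimately show ?thesis
    by (simp add: field_simps)
qed

lemma integrable_inverse_cosh: "integrable lborel (\<lambda>x::real. 1 / cosh x)"
proof (rule Bochner_Integration.integrable_bound)
  have "integrable lborel (\<lambda>x::real. inverse (1 + x\<^sup>2))"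
    using integrable_inverse_1_plus_square by (simp add: set_integrable_def)
  then show "integrable lborel (\<lambda>x::real. 4 * inverse (1 + x\<^sup>2))"
    by simp
  show "(\<lambda>x::real. 1 / cosh x) \<in> borel_measurable lborel"
    by simp
       (intro borel_measurable_continuous_onI continuous_intros, simp)
  show "AE x in lborel. norm (1 / cosh x) \<le> norm (4 * inverse (1 + x\<^sup>2) :: real)"
    using inverse_cosh_le by (intro AE_I2) (simp add: add_pos_nonneg abs_of_nonneg)
qed

section \<open>Contour integration and the Fourier transform of sech\<close>

lemma cosh_complex_zeroD:
  assumes "cosh z = 0" shows "\<exists>k::int. z = Complex 0 (pi / 2 + k * pi)"
proof -
  from assms have "cos (\<i> * z) = 0" by (simp add: cosh_conv_cos)
  then obtain n :: int where n: "\<i> * z = of_real (n * pi) + of_real pi / 2"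
    unfolding cos_eq_0 by blast
  have "Re z = 0" "Im z = - (n * pi + pi / 2)"
    using arg_cong[OF n, of Im] arg_cong[OF n, of Re] by simp_all
  then have "z = Complex 0 (pi / 2 + of_int (- n - 1) * pi)"
    by (simp add: complex_eq_iff algebra_simps)
  then show ?thesis by blast
qed

text \<open>Reverse triangle inequality, with the smaller exponential bounded by 1. As the bound
  depends only on \<open>Re z\<close>, it is uniform along a vertical line.\<close>

lemma norm_cosh_ge: "norm (cosh z) \<ge> (exp \<bar>Re z\<bar> - 1) / 2" for z :: complex
proof -
  have "norm (cosh z) = norm (exp z + exp (- z)) / 2"
    by (simp add: cosh_field_def norm_divide)
  moreover have "norm (exp z + exp (- z)) \<ge> norm (exp z) - norm (exp (- z))"
    "norm (exp (- z) + exp z) \<ge> norm (exp (- z)) - norm (exp z)"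
    by (rule norm_diff_ineq)+
  moreover have "norm (exp z) = exp (Re z)" "norm (exp (- z)) = exp (- Re z)"
    by (simp_all add: norm_exp_eq_Re)
  moreover have "exp \<bar>Re z\<bar> - 1 \<le> \<bar>exp (Re z) - exp (- Re z)\<bar>"
    by (auto simp: abs_if)
  ultimately show ?thesis
    by (simp add: add.commute abs_le_iff)
qed

text \<open>Residue theorem on the rectangle over \<open>{-R..R}\<close> of height
  \<open>pi\<close>. Translation by \<open>\<i> * pi\<close> multiplies \<open>h\<close> by
  \<open>- exp (- (pi * t))\<close>, so the top side, run backwards, is a multiple of the bottom
  side. The only pole inside is \<open>\<i> * pi / 2\<close>, and the error term bounds the two
  vertical sides.\<close>

lemma integral_fourier_sech_box:
  fixes t R :: real and h :: "complex \<Rightarrow> complex"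
  assumes "R > 0"
  defines "h \<equiv> \<lambda>z::complex. exp (\<i> * t * z) / cosh z"
  shows "norm ((1 + exp (- (pi * t))) * integral {-R..R} (\<lambda>x. h (of_real x)) - 2 * pi * exp (- (pi * t / 2)))
    \<le> 4 * pi * exp (pi * \<bar>t\<bar>) / (exp R - 1)"
proof -
  \<comment> \<open>A convex open strip around the rectangle, thin enough to contain a single zero
    of \<open>cosh\<close>: the neighbouring zeros have imaginary parts \<open>- pi / 2 < -1\<close>
    and \<open>3 * pi / 2 > 4\<close>.\<close>
  define S where "S = {z. -1 < Im z} \<inter> {z. Im z < 4}"
  define p where "p = Complex 0 (pi / 2)"
  have S: "open S" "convex S"
    unfolding S_def
    by (auto intro!: open_Int open_halfspace_Im_gt open_halfspace_Im_lt convex_Int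
        convex_halfspace_Im_gt convex_halfspace_Im_lt)
  have pS: "p \<in> S"
    using pi_gt3 pi_less_4 by (simp add: S_def p_def)
  have cosh0: "z = p" if z: "cosh z = 0" "z \<in> S" for z
  proof -
    obtain k :: int where k: "z = Complex 0 (pi / 2 + k * pi)"
      using cosh_complex_zeroD z by blast
    have "-1 < pi / 2 + k * pi" "pi / 2 + k * pi < 4"
      using z(2) k by (simp_all add: S_def)
    moreover have "k \<ge> 1 \<Longrightarrow> k * pi \<ge> 1 * pi" "k \<le> -1 \<Longrightarrow> k * pi \<le> (-1) * pi"
      by (intro mult_right_mono; simp)+
    ultimately have "k = 0"
      using pi_gt3 by linarith
    then show ?thesis by (simp add: k p_def)
  qed
  have holo: "h holomorphic_on S - {p}"
    unfolding h_def by (intro holomorphic_intros analytic_imp_holomorphic[OF analytic_on_cosh] analytic_on_ident) (use cosh0 in auto)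
  have exp_p: "exp p = \<i>" "exp (- p) = - \<i>"
    by (simp_all add: p_def exp_eq_polar cis.ctr complex_eq_iff Re_exp Im_exp)
  have res: "residue h p = exp (\<i> * t * p) / sinh p"
    unfolding h_def
    by (rule residue_simple_pole_deriv[where s = S])
       (use S pS exp_p in \<open>auto intro!: holomorphic_intros convex_connected derivative_eq_intros
          simp: cosh_field_def sinh_field_def\<close>)
  have sp: "sinh p = \<i>"
    by (simp add: sinh_field_def exp_p)
  have ep: "exp (\<i> * t * p) = exp (- (pi * t / 2))"
    by (simp add: p_def exp_of_real[symmetric] complex_eq_iff Re_exp Im_exp mult.commute)
  define a1 a2 a3 a4 where "a1 = Complex (-R) 0" and "a2 = Complex R 0"
    and "a3 = Complex R pi" and "a4 = Complex (-R) pi"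
  have path: "path_image (rectpath a1 a3) \<subseteq> S - {p}"
    using assms pi_gt3 pi_less_4
    by (auto simp: path_image_rectpath a1_def a3_def S_def p_def)
  have sum: "contour_integral (rectpath a1 a3) h = 2 * pi * \<i> * (\<Sum>q\<in>{p}. winding_number (rectpath a1 a3) q * residue h q)"
  proof (rule Residue_theorem[where S = S])
    show "\<forall>z. z \<notin> S \<longrightarrow> winding_number (rectpath a1 a3) z = 0"
      using assms pi_gt3 pi_less_4
      by (auto intro!: winding_number_rectpath_outside simp: a1_def a3_def S_def in_cbox_complex_iff)
  qed (use S holo path in \<open>auto intro: convex_connected\<close>)
  have wind: "winding_number (rectpath a1 a3) p = 1"
    using assms by (intro winding_number_rectpath) (auto simp: in_box_complex_iff a1_def a3_def p_def)
  have "(\<Sum>q\<in>{p}. winding_number (rectpath a1 a3) q * residue h q) = exp (- (pi * t / 2)) / \<i>"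
    by (simp only: sum.insert finite.emptyI empty_iff sum.empty wind res sp ep not_False_eq_True) simp
  with sum have "contour_integral (rectpath a1 a3) h = 2 * pi * \<i> * (exp (- (pi * t / 2)) / \<i>)"
    by (simp only:)
  also have "\<dots> = 2 * pi * exp (- (pi * t / 2))"
  proof -
    have "c * k * (d / k) = c * d" if "k \<noteq> 0" for c d k :: complex
      using that by simp
    then show ?thesis
      by (simp only: of_real_mult complex_i_not_zero not_False_eq_True)
  qed
  finally have total: "contour_integral (rectpath a1 a3) h = 2 * pi * exp (- (pi * t / 2))" .
  have segs: "closed_segment a1 a2 \<union> closed_segment a2 a3 \<union> closed_segment a3 a4 \<union> closed_segment a4 a1
      \<subseteq> S - {p}"
  proof -
    have "path_image (rectpath a1 a3) = closed_segment a1 a2 \<union> closed_segment a2 a3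
        \<union> closed_segment a3 a4 \<union> closed_segment a4 a1"
      by (simp add: rectpath_def Let_def path_image_join a1_def a2_def a3_def a4_def Un_assoc)
    then show ?thesis using path by (simp only:)
  qed
  have int: "h contour_integrable_on linepath a1 a2" "h contour_integrable_on linepath a2 a3"
    "h contour_integrable_on linepath a3 a4" "h contour_integrable_on linepath a4 a1"
    using segs by (auto intro!: contour_integrable_continuous_linepath
        holomorphic_on_imp_continuous_on holomorphic_on_subset[OF holo])
  have split: "contour_integral (rectpath a1 a3) h =
      contour_integral (linepath a1 a2) h + (contour_integral (linepath a2 a3) h
      + (contour_integral (linepath a3 a4) h + contour_integral (linepath a4 a1) h))"
    using int by (simp add: rectpath_def Let_def a1_def a2_def a3_def a4_def)
  have bot: "contour_integral (linepath a1 a2) h = integral {-R..R} (\<lambda>x. h (of_real x))"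
    using assms by (subst contour_integral_linepath_Reals_eq)
      (auto simp: a1_def a2_def complex_is_Real_iff)
  have shift: "h (z + \<i> * pi) = - exp (- (pi * t)) * h z" for z
  proof -
    have "cosh (z + \<i> * pi) = - cosh z"
      by (simp add: cosh_field_def exp_add exp_diff minus_divide_left)
    moreover have "exp (\<i> * t * (z + \<i> * pi)) = exp (\<i> * t * z) * exp (- (pi * t))"
      by (simp add: exp_of_real[symmetric] exp_add[symmetric] algebra_simps)
    ultimately show ?thesis by (simp add: h_def)
  qed
  \<comment> \<open>Reversed, the top side is the bottom side translated by
    \<open>\<i> * pi\<close>.\<close>
  have "contour_integral (linepath a3 a4) h = - contour_integral (linepath a4 a3) h"
    using contour_integral_reverse_linepath[of a3 a4 h] int(3)
    by (metis contour_integral_reversepath reversepath_linepath valid_path_linepath)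
  also have "contour_integral (linepath a4 a3) h = contour_integral (linepath a1 a2) (\<lambda>z. h (z + \<i> * pi))"
    unfolding contour_integral_integral
  proof (rule integral_cong)
    fix x :: real
    have shifted: "a4 = a1 + \<i> * pi" "a3 = a2 + \<i> * pi"
      by (simp_all add: a1_def a2_def a3_def a4_def complex_eq_iff)
    have "linepath a4 a3 x = linepath a1 a2 x + \<i> * pi"
      unfolding shifted linepath_def by (simp add: complex_eq_iff algebra_simps)
    then show "h (linepath a4 a3 x) * vector_derivative (linepath a4 a3) (at x)
        = h (linepath a1 a2 x + \<i> * pi) * vector_derivative (linepath a1 a2) (at x)"
      by (simp only: vector_derivative_linepath_at) (simp add: shifted)
  qed
  also have "\<dots> = - exp (- (pi * t)) * contour_integral (linepath a1 a2) h"
    unfolding shift by (rule contour_integral_lmul[OF int(1)])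
  finally have top: "contour_integral (linepath a3 a4) h
      = exp (- (pi * t)) * contour_integral (linepath a1 a2) h" by simp
  \<comment> \<open>Bound for \<open>h\<close> on both vertical sides: the numerator has norm
    \<open>exp (- (t * Im z))\<close> with \<open>Im z\<close> between 0 and \<open>pi\<close>, and
    the denominator is controlled by \<open>norm_cosh_ge\<close>. Each side has length
    \<open>pi\<close>.\<close>
  define B where "B = 2 * exp (pi * \<bar>t\<bar>) / (exp R - 1)"
  have eR: "exp R > 1" using assms by simp
  have hB: "norm (h z) \<le> B" if "\<bar>Re z\<bar> = R" "0 \<le> Im z" "Im z \<le> pi" for z
  proof -
    have "norm (exp (\<i> * t * z)) = exp (- (t * Im z))"
      by (simp add: norm_exp_eq_Re)
    also have "- (t * Im z) \<le> \<bar>t\<bar> * pi"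
      using mult_mono[of "\<bar>t\<bar>" "\<bar>t\<bar>" "Im z" pi] that abs_ge_minus_self[of t]
      by (smt (verit, best) mult_minus_left mult_right_mono)
    finally have "norm (exp (\<i> * t * z)) \<le> exp (pi * \<bar>t\<bar>)"
      by (simp add: mult.commute)
    moreover have "norm (cosh z) \<ge> (exp R - 1) / 2"
      using norm_cosh_ge[of z] that by simp
    ultimately have "norm (h z) \<le> exp (pi * \<bar>t\<bar>) / ((exp R - 1) / 2)"
      unfolding h_def norm_divide using eR by (intro frac_le) auto
    then show ?thesis by (simp add: B_def mult.commute)
  qed
  have B0: "B \<ge> 0" using eR by (simp add: B_def)
  have "norm (contour_integral (linepath a2 a3) h) \<le> B * norm (a3 - a2)"
    using assms by (intro contour_integral_bound_linepath int hB B0)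
      (auto simp: a2_def a3_def closed_segment_same_Re closed_segment_eq_real_ivl)
  moreover have "norm (contour_integral (linepath a4 a1) h) \<le> B * norm (a1 - a4)"
    using assms by (intro contour_integral_bound_linepath int hB B0)
      (auto simp: a1_def a4_def closed_segment_same_Re closed_segment_eq_real_ivl
        not_le[THEN iffD2, OF pi_gt_zero])
  moreover have "norm (a3 - a2) = pi" "norm (a1 - a4) = pi"
    by (simp_all add: a1_def a2_def a3_def a4_def cmod_def)
  ultimately have "norm (contour_integral (linepath a2 a3) h + contour_integral (linepath a4 a1) h)
     \<le> B * pi + B * pi"
    by (metis norm_triangle_mono)
  moreover have "(1 + exp (- (pi * t))) * integral {-R..R} (\<lambda>x. h (of_real x)) - 2 * pi * exp (- (pi * t / 2))
     = - (contour_integral (linepath a2 a3) h + contour_integral (linepath a4 a1) h)"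
  proof -
    have "(1 + e) * I - E = - (V + W)" if "I + (V + (e * I + W)) = E" for e I E V W :: complex
      using that by (auto simp: algebra_simps)
    from this[OF total[unfolded split top bot]] show ?thesis
      by (simp only: of_real_add of_real_1)
  qed
  ultimately have "norm ((1 + exp (- (pi * t))) * integral {-R..R} (\<lambda>x. h (of_real x)) - 2 * pi * exp (- (pi * t / 2)))
      \<le> B * pi + B * pi"
    by (simp only: norm_minus_cancel)
  also have "B * pi + B * pi = 4 * pi * exp (pi * \<bar>t\<bar>) / (exp R - 1)"
    by (simp add: B_def)
  finally show ?thesis .
qed

text \<open>As the box grows, the estimate becomes
  \<open>(1 + exp (- (pi * t))) * I = 2 * pi * exp (- (pi * t / 2))\<close> for the integral
  \<open>I\<close> over the line. Taking real parts and pulling \<open>exp (- (pi * t / 2))\<close>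
  out of the first factor leaves the hyperbolic cosine.\<close>

lemma fourier_sech:
  fixes t :: real
  shows "(LBINT x. cos (t * x) / cosh x) = pi / cosh (pi * t / 2)"
proof -
  define h :: "complex \<Rightarrow> complex" where "h = (\<lambda>z. exp (\<i> * t * z) / cosh z)"
  define F where "F = (\<lambda>x::real. h (of_real x))"
  have F: "F x = iexp (t * x) * complex_of_real (1 / cosh x)" for x
    by (simp add: F_def h_def cosh_field_def exp_of_real[symmetric] mult.assoc)
  have normF: "norm (F x) = 1 / cosh x" for x
    by (simp add: F norm_mult norm_divide del: of_real_mult)
  have contF: "continuous_on A F" for A
    unfolding F[abs_def] by (intro continuous_intros) simp_all
  then have measF [measurable]: "F \<in> borel_measurable borel"
    by (rule borel_measurable_continuous_onI)
  have intF: "integrable lborel F"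
    by (rule Bochner_Integration.integrable_bound[OF integrable_inverse_cosh])
       (simp_all add: normF)
  define I where "I = integral\<^sup>L lborel F"
  \<comment> \<open>The box estimate concerns the gauge integral, dominated convergence the Lebesgue
    integral; on a compact interval they agree for the continuous \<open>F\<close>.\<close>
  have box: "(LINT x|lborel. indicator {- real n..real n} x *\<^sub>R F x) = integral {- real n..real n} F" for n
    using set_borel_integral_eq_integral(2)[of "{- real n..real n}" F]
      borel_integrable_atLeastAtMost'[OF contF, of "- real n" "real n"]
    by (simp add: set_lebesgue_integral_def)
  have "(\<lambda>n. LINT x|lborel. indicator {- real n..real n} x *\<^sub>R F x) \<longlonglongrightarrow> I"
    unfolding I_def
  proof (rule integral_dominated_convergence[where w = "\<lambda>x. 1 / cosh x"])
    show "AE x in lborel. (\<lambda>n. indicator {- real n..real n} x *\<^sub>R F x) \<longlonglongrightarrow> F x"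
    proof (intro AE_I2 tendsto_eventually)
      fix x :: real
      obtain N :: nat where "\<bar>x\<bar> \<le> real N" using real_arch_simple by blast
      then have "\<forall>n\<ge>N. indicator {- real n..real n} x *\<^sub>R F x = F x"
        by (auto simp: indicator_def abs_le_iff)
      then show "\<forall>\<^sub>F n in sequentially. indicator {- real n..real n} x *\<^sub>R F x = F x"
        unfolding eventually_sequentially by blast
    qed
  qed (auto simp: integrable_inverse_cosh normF indicator_def)
  then have lim: "(\<lambda>n. integral {- real n..real n} F) \<longlonglongrightarrow> I"
    by (simp only: box)
  have "(\<lambda>n. (1 + exp (- (pi * t))) * integral {- real n..real n} F - 2 * pi * exp (- (pi * t / 2))) \<longlonglongrightarrow> 0"
  proof (rule Lim_null_comparison)
    show "\<forall>\<^sub>F n in sequentially. norm ((1 + exp (- (pi * t))) * integral {- real n..real n} F - 2 * pi * exp (- (pi * t / 2)))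
        \<le> 4 * pi * exp (pi * \<bar>t\<bar>) / (exp (real n) - 1)"
      using eventually_gt_at_top[of 0]
      by eventually_elim (use integral_fourier_sech_box[of _ t] in \<open>simp add: F_def h_def\<close>)
    show "(\<lambda>n. 4 * pi * exp (pi * \<bar>t\<bar>) / (exp (real n) - 1)) \<longlonglongrightarrow> 0"
      by real_asymp
  qed
  moreover have "(\<lambda>n. (1 + exp (- (pi * t))) * integral {- real n..real n} F - 2 * pi * exp (- (pi * t / 2)))
      \<longlonglongrightarrow> (1 + exp (- (pi * t))) * I - 2 * pi * exp (- (pi * t / 2))"
    by (intro tendsto_intros lim)
  ultimately have eq: "(1 + exp (- (pi * t))) * I = 2 * pi * exp (- (pi * t / 2))"
    using LIMSEQ_unique by fastforce
  have "Re I = (LBINT x. Re (F x))"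
    unfolding I_def using intF by simp
  also have "\<dots> = (LBINT x. cos (t * x) / cosh x)"
    by (intro Bochner_Integration.integral_cong) (simp_all add: F Re_exp del: of_real_divide)
  finally have ReI: "Re I = (LBINT x. cos (t * x) / cosh x)" .
  have "(1 + exp (- (pi * t))) * Re I = 2 * pi * exp (- (pi * t / 2))"
    using arg_cong[OF eq, of Re] by simp
  moreover have "1 + exp (- (pi * t)) = 2 * exp (- (pi * t / 2)) * cosh (pi * t / 2)"
    by (simp add: cosh_field_def field_simps mult_exp_exp)
  ultimately show ?thesis
    by (simp add: ReI field_simps)
qed

section \<open>The Gaussian, and scaled Fourier transforms\<close>

lemma integrable_gaussian: "integrable lborel (\<lambda>x::real. exp (- x\<^sup>2))"
  using has_bochner_integral_even_function[OF gaussian_moment_0]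
  by (auto simp: has_bochner_integral_iff)

text \<open>This is the characteristic function of the standard normal distribution at
  \<open>t = sqrt 2 * s\<close>. Substituting \<open>x = sqrt 2 * y\<close> turns its density into a
  multiple of \<open>exp (- y\<^sup>2)\<close> and the phase \<open>t * x\<close> into
  \<open>2 * s * y\<close>.\<close>

lemma fourier_gaussian:
  fixes s :: real
  shows "(LBINT y. cos (2 * s * y) * exp (- y\<^sup>2)) = sqrt pi * exp (- s\<^sup>2)"
proof -
  define t where "t = sqrt 2 * s"
  have "integrable std_normal_distribution (\<lambda>x. iexp (t * x))"
  proof -
    interpret real_distribution std_normal_distribution
      by (rule real_dist_normal_dist)
    show ?thesis by (intro integrable_iexp) simp_all
  qed
  then have "Re (char std_normal_distribution t) = (LINT x|std_normal_distribution. Re (iexp (t * x)))"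
    unfolding char_def by (rule integral_Re[symmetric])
  also have "\<dots> = (LBINT x. std_normal_density x *\<^sub>R Re (iexp (t * x)))"
    by (intro integral_density) auto
  also have "\<dots> = (LBINT x. 1 / sqrt (2 * pi) * exp (- x\<^sup>2 / 2) * cos (t * x))"
    by (simp add: std_normal_density_def Re_exp)
  also have "\<dots> = sqrt 2 * (LBINT y. 1 / sqrt (2 * pi) * exp (- (sqrt 2 * y)\<^sup>2 / 2) * cos (t * (sqrt 2 * y)))"
    by (subst lborel_integral_real_affine[where c = "sqrt 2" and t = 0]) simp_all
  also have "\<dots> = sqrt 2 * (LBINT y. 1 / sqrt (2 * pi) * (cos (2 * s * y) * exp (- y\<^sup>2)))"
    by (simp add: t_def power_mult_distrib mult_ac)
  also have "\<dots> = (LBINT y. cos (2 * s * y) * exp (- y\<^sup>2)) / sqrt pi"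
    by (simp add: real_sqrt_mult)
  also have "Re (char std_normal_distribution t) = exp (- s\<^sup>2)"
    by (simp add: char_std_normal_distribution t_def power_mult_distrib del: exp_of_real)
  finally show ?thesis
    by (simp add: field_simps)
qed

text \<open>\<open>fourier_sech\<close> at frequency \<open>4 * y / \<alpha>\<close>, with
  \<open>x = \<alpha> * s / 2\<close>; the relation between \<alpha> and \<beta> makes the resulting
  argument \<open>\<beta> * y\<close>. It is applied from right to left, to open up sech as a cosine
  integral.\<close>

lemma fourier_sech_scaled:
  fixes \<alpha> \<beta> y :: real
  assumes "\<alpha> > 0" "\<alpha> * \<beta> = 2 * pi"
  shows "(LBINT s. cos (2 * s * y) / cosh (\<alpha> * s / 2)) = \<beta> / cosh (\<beta> * y)"
proof -
  have \<beta>: "\<beta> = 2 * pi / \<alpha>" using assms by (simp add: field_simps)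
  have "pi / cosh (\<beta> * y) = (LBINT x. cos (4 * y / \<alpha> * x) / cosh x)"
  proof (subst fourier_sech)
    have "pi * (4 * y / \<alpha>) / 2 = \<beta> * y"
      using assms by (simp add: \<beta>)
    then show "pi / cosh (\<beta> * y) = pi / cosh (pi * (4 * y / \<alpha>) / 2)"
      by simp
  qed
  also have "\<dots> = \<alpha> / 2 * (LBINT s. cos (4 * y / \<alpha> * (\<alpha> / 2 * s)) / cosh (\<alpha> / 2 * s))"
    using assms by (subst lborel_integral_real_affine[where c = "\<alpha> / 2" and t = 0]) simp_all
  also have "(\<lambda>s. cos (4 * y / \<alpha> * (\<alpha> / 2 * s)) / cosh (\<alpha> / 2 * s)) = (\<lambda>s. cos (2 * s * y) / cosh (\<alpha> * s / 2))"
    using assms by (simp add: fun_eq_iff field_simps)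
  finally have "(LBINT s. cos (2 * s * y) / cosh (\<alpha> * s / 2)) = 2 / \<alpha> * (pi / cosh (\<beta> * y))"
    using assms(1) by (simp only:) simp
  then show ?thesis
    by (simp add: \<beta>)
qed

lemma integrable_inverse_cosh_scaled:
  fixes a :: real
  assumes "a \<noteq> 0"
  shows "integrable lborel (\<lambda>x. 1 / cosh (a * x))"
  using lborel_integrable_real_affine[OF integrable_inverse_cosh assms, of 0] by simp

section \<open>Integrable kernels on the plane, and the inner integral in \<open>y\<close>\<close>

lemma continuous_on_div_cosh [continuous_intros]:
  fixes f g :: "'a::topological_space \<Rightarrow> real"
  assumes "continuous_on A f" "continuous_on A g"
  shows "continuous_on A (\<lambda>x. f x / cosh (g x))"
  using assms by (intro continuous_intros) simp_all

lemma integrable_product: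
  fixes f g :: "real \<Rightarrow> real"
  assumes f: "integrable lborel f" and g: "integrable lborel g"
  shows "integrable (lborel \<Otimes>\<^sub>M lborel) (\<lambda>(x, y). f x * g y)"
proof -
  note [measurable] = borel_measurable_integrable[OF f] borel_measurable_integrable[OF g]
  show ?thesis
    by (intro lborel_pair.Fubini_integrable)
       (auto simp: norm_mult abs_mult intro!: integrable_mult_left integrable_mult_right integrable_abs f g)
qed

text \<open>Domination by a separated kernel; continuity supplies measurability on the product. This
  is what justifies the exchanges of integrals below.\<close>

lemma integrable_product_bound:
  fixes f :: "real \<times> real \<Rightarrow> real" and g h :: "real \<Rightarrow> real"
  assumes "integrable lborel g" "integrable lborel h"
    and "continuous_on UNIV f"
    and "\<And>x y. \<bar>f (x, y)\<bar> \<le> g x * h y"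
  shows "integrable (lborel \<Otimes>\<^sub>M lborel) f"
proof (rule Bochner_Integration.integrable_bound[OF integrable_product[OF assms(1,2)]])
  show "f \<in> borel_measurable (lborel \<Otimes>\<^sub>M lborel)"
    unfolding lborel_prod using borel_measurable_continuous_onI[OF assms(3)] by simp
  show "AE z in lborel \<Otimes>\<^sub>M lborel. norm (f z) \<le> norm (case z of (x, y) \<Rightarrow> g x * h y)"
    using assms(4) by (intro AE_I2) (auto intro: order_trans[OF _ abs_ge_self])
qed

text \<open>Writing sech as a cosine integral in \<open>s\<close> and exchanging the integrals
  leaves a product of two cosines against a Gaussian. The product-to-sum formula yields Gaussians
  centred at \<open>x\<close> and \<open>- x\<close>, which contribute equally by the reflection of
  \<open>s\<close>; then \<open>w = x - s\<close>.\<close>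

lemma fourier_gaussian_sech:
  fixes \<alpha> \<beta> x :: real
  assumes "\<alpha> > 0" "\<beta> > 0" "\<alpha> * \<beta> = 2 * pi"
  shows "(LBINT y. cos (2 * x * y) * exp (- y\<^sup>2) / cosh (\<beta> * y))
    = \<alpha> / (2 * sqrt pi) * (LBINT w. exp (- w\<^sup>2) / cosh (\<alpha> * (x - w) / 2))"
proof -
  have sech: "integrable lborel (\<lambda>s. 1 / cosh (\<alpha> * s / 2))"
    using integrable_inverse_cosh_scaled[of "\<alpha> / 2"] assms by simp
  have int: "integrable (lborel \<Otimes>\<^sub>M lborel)
      (\<lambda>(y, s). cos (2 * x * y) * exp (- y\<^sup>2) * (cos (2 * s * y) / cosh (\<alpha> * s / 2)))"
  proof (rule integrable_product_bound[OF integrable_gaussian sech])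
    show "continuous_on UNIV (\<lambda>(y, s). cos (2 * x * y) * exp (- y\<^sup>2) * (cos (2 * s * y) / cosh (\<alpha> * s / 2)))"
      unfolding case_prod_beta by (intro continuous_intros; simp)
    fix y s :: real
    have "\<bar>cos (2 * x * y)\<bar> * \<bar>cos (2 * s * y)\<bar> \<le> 1 * 1"
      by (intro mult_mono) simp_all
    then have "(\<bar>cos (2 * x * y)\<bar> * \<bar>cos (2 * s * y)\<bar>) * (exp (- y\<^sup>2) * (1 / cosh (\<alpha> * s / 2)))
        \<le> 1 * (exp (- y\<^sup>2) * (1 / cosh (\<alpha> * s / 2)))"
      by (intro mult_right_mono) simp_all
    then show "\<bar>case (y, s) of (y, s) \<Rightarrow> cos (2 * x * y) * exp (- y\<^sup>2) * (cos (2 * s * y) / cosh (\<alpha> * s / 2))\<bar>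
        \<le> exp (- y\<^sup>2) * (1 / cosh (\<alpha> * s / 2))"
      by (simp add: abs_mult mult_ac)
  qed
  have gs: "integrable lborel (\<lambda>y. cos (2 * s * y) * exp (- y\<^sup>2))" for s :: real
    by (rule Bochner_Integration.integrable_bound[OF integrable_gaussian])
       (auto simp: abs_mult)
  \<comment> \<open>The factor \<beta> completes the exact right-hand side of
    \<open>fourier_sech_scaled\<close>.\<close>
  have "\<beta> * (LBINT y. cos (2 * x * y) * exp (- y\<^sup>2) / cosh (\<beta> * y))
      = (LBINT y. cos (2 * x * y) * exp (- y\<^sup>2) * (\<beta> / cosh (\<beta> * y)))"
    by (simp flip: integral_mult_right_zero add: mult_ac)
  also have "\<dots> = (LBINT y. LBINT s. cos (2 * x * y) * exp (- y\<^sup>2) * (cos (2 * s * y) / cosh (\<alpha> * s / 2)))"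
    by (simp only: fourier_sech_scaled[OF assms(1,3), symmetric] integral_mult_right_zero)
  also have "\<dots> = (LBINT s. LBINT y. cos (2 * x * y) * exp (- y\<^sup>2) * (cos (2 * s * y) / cosh (\<alpha> * s / 2)))"
    using lborel_pair.Fubini_integral[OF int] by simp
  also have "\<dots> = (LBINT s. sqrt pi / 2 * (exp (- (x - s)\<^sup>2) / cosh (\<alpha> * s / 2))
      + sqrt pi / 2 * (exp (- (x + s)\<^sup>2) / cosh (\<alpha> * s / 2)))"
  proof (intro Bochner_Integration.integral_cong refl)
    fix s :: real
    have "(LBINT y. cos (2 * x * y) * exp (- y\<^sup>2) * (cos (2 * s * y) / cosh (\<alpha> * s / 2)))
        = (LBINT y. (cos (2 * (x - s) * y) * exp (- y\<^sup>2) + cos (2 * (x + s) * y) * exp (- y\<^sup>2))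
           * (1 / (2 * cosh (\<alpha> * s / 2))))"
    proof (intro Bochner_Integration.integral_cong refl)
      fix y :: real
      have "cos (2 * x * y) * cos (2 * s * y) = (cos (2 * (x - s) * y) + cos (2 * (x + s) * y)) / 2"
        by (simp only: cos_times_cos left_diff_distrib right_diff_distrib distrib_left distrib_right)
      then have "cos (2 * x * y) * cos (2 * s * y) * (exp (- y\<^sup>2) / cosh (\<alpha> * s / 2))
        = (cos (2 * (x - s) * y) + cos (2 * (x + s) * y)) / 2 * (exp (- y\<^sup>2) / cosh (\<alpha> * s / 2))"
        by (simp only:)
      then show "cos (2 * x * y) * exp (- y\<^sup>2) * (cos (2 * s * y) / cosh (\<alpha> * s / 2))
        = (cos (2 * (x - s) * y) * exp (- y\<^sup>2) + cos (2 * (x + s) * y) * exp (- y\<^sup>2))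
           * (1 / (2 * cosh (\<alpha> * s / 2)))"
        by (simp add: mult_ac distrib_left)
    qed
    also have "\<dots> = (sqrt pi * exp (- (x - s)\<^sup>2) + sqrt pi * exp (- (x + s)\<^sup>2)) * (1 / (2 * cosh (\<alpha> * s / 2)))"
      by (subst integral_mult_left_zero, subst Bochner_Integration.integral_add[OF gs gs])
         (simp only: fourier_gaussian)
    also have "\<dots> = sqrt pi / 2 * (exp (- (x - s)\<^sup>2) / cosh (\<alpha> * s / 2))
      + sqrt pi / 2 * (exp (- (x + s)\<^sup>2) / cosh (\<alpha> * s / 2))"
      by (simp add: field_simps)
    finally show "(LBINT y. cos (2 * x * y) * exp (- y\<^sup>2) * (cos (2 * s * y) / cosh (\<alpha> * s / 2))) = \<dots>" .
  qed
  also have "\<dots> = sqrt pi / 2 * (LBINT s. exp (- (x - s)\<^sup>2) / cosh (\<alpha> * s / 2))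
      + sqrt pi / 2 * (LBINT s. exp (- (x + s)\<^sup>2) / cosh (\<alpha> * s / 2))"
  proof -
    \<comment> \<open>The Gaussian is at most 1, so sech dominates; the parameter \<open>c\<close>
      covers both signs at once.\<close>
    have "integrable lborel (\<lambda>s. exp (- (x + c * s)\<^sup>2) / cosh (\<alpha> * s / 2))" for c :: real
      by (rule Bochner_Integration.integrable_bound[OF sech])
         (auto intro!: borel_measurable_continuous_onI continuous_intros divide_right_mono)
    from this[of 1] this[of "-1"]
    have plus: "integrable lborel (\<lambda>s. exp (- (x + s)\<^sup>2) / cosh (\<alpha> * s / 2))"
      and minus: "integrable lborel (\<lambda>s. exp (- (x - s)\<^sup>2) / cosh (\<alpha> * s / 2))"
      by simp_all
    show ?thesis
      by (simp only: Bochner_Integration.integral_add[OF integrable_mult_right[OF minus]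
            integrable_mult_right[OF plus]] integral_mult_right_zero)
  qed
  also have "(LBINT s. exp (- (x + s)\<^sup>2) / cosh (\<alpha> * s / 2)) = (LBINT s. exp (- (x - s)\<^sup>2) / cosh (\<alpha> * s / 2))"
    by (subst lborel_integral_real_affine[where c = "-1" and t = 0]) simp_all
  also have "(LBINT s. exp (- (x - s)\<^sup>2) / cosh (\<alpha> * s / 2)) = (LBINT w. exp (- w\<^sup>2) / cosh (\<alpha> * (x - w) / 2))"
    by (subst lborel_integral_real_affine[where c = "-1" and t = x]) simp_all
  finally have "\<beta> * (LBINT y. cos (2 * x * y) * exp (- y\<^sup>2) / cosh (\<beta> * y))
     = sqrt pi * (LBINT w. exp (- w\<^sup>2) / cosh (\<alpha> * (x - w) / 2))"
    by simp
  \<comment> \<open>The constant is \<open>sqrt pi / \<beta>\<close>, rewritten through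
    \<open>\<alpha> * \<beta> = 2 * pi\<close>.\<close>
  moreover have "J = \<alpha> / (2 * sqrt pi) * K" if "\<beta> * J = sqrt pi * K" for J K
  proof -
    have "2 * (sqrt pi * sqrt pi) * J = (\<alpha> * \<beta>) * J"
      by (simp add: assms(3))
    also have "\<dots> = \<alpha> * (sqrt pi * K)"
      by (simp only: mult.assoc that)
    finally have "sqrt pi * (2 * sqrt pi * J) = sqrt pi * (\<alpha> * K)"
      by (simp only: mult_ac)
    then have "2 * sqrt pi * J = \<alpha> * K"
      by (subst (asm) mult_cancel_left) simp
    then show ?thesis
      by (simp add: field_simps)
  qed
  ultimately show ?thesis
    by blast
qed

section \<open>Symmetrisation and separation of variables\<close>

definition cosh_ratio_integral :: "real \<Rightarrow> real" where
  "cosh_ratio_integral a = (LBINT x. cosh (a * x / 2) / cosh (a * x) * exp (- x\<^sup>2))"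

text \<open>\<open>cosh\<close> is even and increases on the nonnegative axis. The bound lets the
  plain Gaussian dominate the integrand of \<open>cosh_ratio_integral\<close>.\<close>

lemma cosh_ratio_le_1: "cosh (u / 2) / cosh u \<le> (1::real)"
proof -
  have "cosh (\<bar>u\<bar> / 2) \<le> cosh \<bar>u\<bar>"
    by (subst cosh_real_nonneg_le_iff) simp_all
  moreover have "cosh (\<bar>u\<bar> / 2) = cosh (u / 2)" "cosh \<bar>u\<bar> = cosh u"
    by (simp_all add: abs_if)
  ultimately show ?thesis by (simp add: divide_le_eq_1)
qed

lemma cosh_ratio_integrable:
  fixes a :: real
  shows "integrable lborel (\<lambda>x. cosh (a * x / 2) / cosh (a * x) * exp (- x\<^sup>2))"
proof (rule Bochner_Integration.integrable_bound[OF integrable_gaussian])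
  show "(\<lambda>x. cosh (a * x / 2) / cosh (a * x) * exp (- x\<^sup>2)) \<in> borel_measurable lborel"
    by (auto intro!: borel_measurable_continuous_onI continuous_intros)
  show "AE x in lborel. norm (cosh (a * x / 2) / cosh (a * x) * exp (- x\<^sup>2)) \<le> norm (exp (- x\<^sup>2))"
    using mult_right_mono[OF cosh_ratio_le_1] by (intro AE_I2) (fastforce simp: abs_mult)
qed

text \<open>Two sum-to-product formulas do the work. Adding the swapped kernel puts
  \<open>cosh (a * x) + cosh (a * w)\<close> in the numerator, whose factor
  \<open>cosh (a * (x - w) / 2)\<close> cancels the one coupling the variables in the denominator.
  Adding the reflected kernel then splits the remaining \<open>cosh (a * (x + w) / 2)\<close> into a
  product.\<close>

lemma double_integral_sech:
  fixes a :: real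
  shows "(LBINT x. LBINT w. exp (- x\<^sup>2) * exp (- w\<^sup>2) / (cosh (a * x) * cosh (a * (x - w) / 2)))
    = (cosh_ratio_integral a)\<^sup>2"
proof -
  let ?P = "lborel \<Otimes>\<^sub>M lborel :: (real \<times> real) measure"
  define k where "k = (\<lambda>x w. exp (- x\<^sup>2) * exp (- w\<^sup>2) / (cosh (a * x) * cosh (a * (x - w) / 2)))"
  define m where "m = (\<lambda>x w. exp (- x\<^sup>2) * exp (- w\<^sup>2) * cosh (a * (x + w) / 2) / (cosh (a * x) * cosh (a * w)))"
  define p where "p = (\<lambda>x w. (cosh (a * x / 2) / cosh (a * x) * exp (- x\<^sup>2)) * (cosh (a * w / 2) / cosh (a * w) * exp (- w\<^sup>2)))"
  have k: "integrable ?P (case_prod k)"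
  proof (rule integrable_product_bound[OF integrable_gaussian integrable_gaussian])
    show "continuous_on UNIV (case_prod k)"
      unfolding k_def case_prod_beta by (intro continuous_intros; simp)
    fix x w :: real
    have "1 * 1 \<le> cosh (a * x) * cosh (a * (x - w) / 2)"
      by (intro mult_mono cosh_real_ge_1) simp_all
    then have "exp (- x\<^sup>2) * exp (- w\<^sup>2) / (cosh (a * x) * cosh (a * (x - w) / 2)) \<le> exp (- x\<^sup>2) * exp (- w\<^sup>2) / 1"
      by (intro frac_le) simp_all
    then show "\<bar>case (x, w) of (x, w) \<Rightarrow> k x w\<bar> \<le> exp (- x\<^sup>2) * exp (- w\<^sup>2)"
      by (simp add: k_def abs_mult)
  qed
  \<comment> \<open>Averaging \<open>k\<close> over the swap \<open>(x, w) \<mapsto> (w, x)\<close> gives \<open>m\<close>, and averaging \<open>m\<close> over the reflection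
    \<open>w \<mapsto> - w\<close> gives the separated kernel \<open>p\<close>.\<close>
  have k': "integrable ?P (\<lambda>(x, w). k w x)"
    using lborel_pair.integrable_product_swap[OF k] by (simp add: case_prod_beta)
  have symm: "k x w + k w x = 2 * m x w" for x w
  proof -
    have num: "cosh (a * x) + cosh (a * w) = 2 * cosh (a * (x + w) / 2) * cosh (a * (x - w) / 2)"
      using cosh_add[of "a * (x + w) / 2" "a * (x - w) / 2"] cosh_diff[of "a * (x + w) / 2" "a * (x - w) / 2"]
      by (simp add: field_simps)
    have even: "cosh (a * (w - x) / 2) = cosh (a * (x - w) / 2)"
      using cosh_minus[of "a * (x - w) / 2"] by (simp add: algebra_simps minus_divide_left)
    have "e / (c * d) + e / (c' * d) = e * (c + c') / (c * c' * d)"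
      if "c \<noteq> 0" "c' \<noteq> 0" "d \<noteq> 0" for e c c' d :: real
      using that by (simp add: field_simps)
    then have "k x w + k w x = exp (- x\<^sup>2) * exp (- w\<^sup>2) * (cosh (a * x) + cosh (a * w))
        / (cosh (a * x) * cosh (a * w) * cosh (a * (x - w) / 2))"
      unfolding k_def even mult.commute[of "exp (- w\<^sup>2)" "exp (- x\<^sup>2)"]
      by (simp only: cosh_real_nonzero not_False_eq_True)
    then show ?thesis
      unfolding num m_def by simp
  qed
  have m: "integrable ?P (case_prod m)"
  proof -
    have "integrable ?P (\<lambda>z. 1/2 * (case_prod k z + (case z of (x, w) \<Rightarrow> k w x)))"
      by (intro integrable_mult_right Bochner_Integration.integrable_add k k')
    moreover have "(\<lambda>z. 1/2 * (case_prod k z + (case z of (x, w) \<Rightarrow> k w x))) = case_prod m"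
      using symm by (auto simp: fun_eq_iff)
    ultimately show ?thesis by simp
  qed
  have symm': "m x w + m x (- w) = 2 * p x w" for x w
  proof -
    have "cosh (a * (x + w) / 2) + cosh (a * (x + - w) / 2) = 2 * cosh (a * x / 2) * cosh (a * w / 2)"
      using cosh_add[of "a * x / 2" "a * w / 2"] cosh_diff[of "a * x / 2" "a * w / 2"]
      by (simp add: algebra_simps add_divide_distrib diff_divide_distrib)
    then show ?thesis
      by (simp add: m_def p_def add_divide_distrib[symmetric] distrib_left[symmetric] mult_ac)
  qed
  have p: "integrable ?P (case_prod p)"
    unfolding p_def by (intro integrable_product cosh_ratio_integrable)
  \<comment> \<open>Integrability follows from the pointwise identity with \<open>p\<close> and
    \<open>m\<close>, without a change of variables on the plane.\<close>
  have m': "integrable ?P (\<lambda>(x, w). m x (- w))"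
  proof -
    have "integrable ?P (\<lambda>z. 2 * case_prod p z - case_prod m z)"
      by (intro integrable_mult_right Bochner_Integration.integrable_diff p m)
    moreover have "(\<lambda>z. 2 * case_prod p z - case_prod m z) = (\<lambda>(x, w). m x (- w))"
      using symm' by (auto simp: fun_eq_iff algebra_simps)
    ultimately show ?thesis by simp
  qed
  have "2 * integral\<^sup>L ?P (case_prod m) = (\<integral>z. case_prod k z + (case z of (x, w) \<Rightarrow> k w x) \<partial>?P)"
    using symm by (simp flip: integral_mult_right_zero add: case_prod_beta)
  also have "\<dots> = integral\<^sup>L ?P (case_prod k) + integral\<^sup>L ?P (\<lambda>(x, w). k w x)"
    by (rule Bochner_Integration.integral_add[OF k k'])
  also have "integral\<^sup>L ?P (\<lambda>(x, w). k w x) = integral\<^sup>L ?P (case_prod k)"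
    using lborel_pair.integral_product_swap[OF borel_measurable_integrable[OF k]] by simp
  finally have km: "integral\<^sup>L ?P (case_prod k) = integral\<^sup>L ?P (case_prod m)"
    by simp
  have "2 * integral\<^sup>L ?P (case_prod p) = (\<integral>z. case_prod m z + (case z of (x, w) \<Rightarrow> m x (- w)) \<partial>?P)"
    using symm' by (simp flip: integral_mult_right_zero add: case_prod_beta)
  also have "\<dots> = integral\<^sup>L ?P (case_prod m) + integral\<^sup>L ?P (\<lambda>(x, w). m x (- w))"
    by (rule Bochner_Integration.integral_add[OF m m'])
  also have "integral\<^sup>L ?P (\<lambda>(x, w). m x (- w)) = (LBINT x. LBINT w. m x (- w))"
    by (rule lborel_pair.integral_fst[OF m', symmetric])
  also have "\<dots> = (LBINT x. LBINT w. m x w)"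
    by (subst (2) lborel_integral_real_affine[where c = "-1" and t = 0]) simp_all
  also have "\<dots> = integral\<^sup>L ?P (case_prod m)"
    by (rule lborel_pair.integral_fst[OF m])
  finally have mp: "integral\<^sup>L ?P (case_prod m) = integral\<^sup>L ?P (case_prod p)"
    by simp
  have "(LBINT x. LBINT w. k x w) = (LBINT x. LBINT w. p x w)"
    unfolding lborel_pair.integral_fst[OF k] lborel_pair.integral_fst[OF p] km mp ..
  also have "\<dots> = (cosh_ratio_integral a)\<^sup>2"
    by (simp only: p_def cosh_ratio_integral_def power2_eq_square integral_mult_right_zero integral_mult_left_zero)
  finally show ?thesis by (simp add: k_def)
qed

section \<open>The original kernel, and passage to the quadrant\<close>

lemma kernel_bound:
  fixes \<alpha> \<beta> x y :: real
  shows "\<bar>cos (2 * x * y) / (cosh (\<alpha> * x) * cosh (\<beta> * y)) * exp (- x\<^sup>2 - y\<^sup>2)\<bar> \<le> exp (- x\<^sup>2) * exp (- y\<^sup>2)"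
proof -
  have "1 * 1 \<le> cosh (\<alpha> * x) * cosh (\<beta> * y)"
    by (intro mult_mono cosh_real_ge_1) simp_all
  then have "\<bar>cos (2 * x * y)\<bar> / (cosh (\<alpha> * x) * cosh (\<beta> * y)) \<le> 1"
    using order_trans[OF abs_cos_le_one[of "2 * x * y"]] by (simp add: divide_le_eq_1)
  then have "\<bar>cos (2 * x * y)\<bar> / (cosh (\<alpha> * x) * cosh (\<beta> * y)) * (exp (- x\<^sup>2) * exp (- y\<^sup>2))
     \<le> 1 * (exp (- x\<^sup>2) * exp (- y\<^sup>2))"
    by (intro mult_right_mono) simp_all
  then show ?thesis
    by (simp add: abs_mult mult_exp_exp)
qed

lemma integrable_kernel:
  fixes \<alpha> \<beta> :: real
  shows "integrable (lborel \<Otimes>\<^sub>M lborel)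
    (\<lambda>(x, y). cos (2 * x * y) / (cosh (\<alpha> * x) * cosh (\<beta> * y)) * exp (- x\<^sup>2 - y\<^sup>2))"
proof (rule integrable_product_bound[OF integrable_gaussian integrable_gaussian])
  show "continuous_on UNIV (\<lambda>(x, y). cos (2 * x * y) / (cosh (\<alpha> * x) * cosh (\<beta> * y)) * exp (- x\<^sup>2 - y\<^sup>2))"
    unfolding case_prod_beta by (intro continuous_intros; simp)
qed (simp only: prod.case kernel_bound)

text \<open>The integral in \<open>y\<close> is \<open>fourier_gaussian_sech\<close>, and what
  remains is \<open>double_integral_sech\<close>. The right-hand side involves only \<alpha>, so
  exchanging the parameters gives a second evaluation.\<close>

lemma double_integral_eq_square:
  fixes \<alpha> \<beta> :: real
  assumes "\<alpha> > 0" "\<beta> > 0" "\<alpha> * \<beta> = 2 * pi"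
  shows "(LBINT x. LBINT y. cos (2 * x * y) / (cosh (\<alpha> * x) * cosh (\<beta> * y)) * exp (- x\<^sup>2 - y\<^sup>2))
    = \<alpha> / (2 * sqrt pi) * (cosh_ratio_integral \<alpha>)\<^sup>2"
proof -
  have "(LBINT x. LBINT y. cos (2 * x * y) / (cosh (\<alpha> * x) * cosh (\<beta> * y)) * exp (- x\<^sup>2 - y\<^sup>2))
    = (LBINT x. LBINT y. exp (- x\<^sup>2) / cosh (\<alpha> * x) * (cos (2 * x * y) * exp (- y\<^sup>2) / cosh (\<beta> * y)))"
    by (simp add: exp_diff exp_minus field_simps)
  also have "\<dots> = (LBINT x. \<alpha> / (2 * sqrt pi) * (LBINT w. exp (- x\<^sup>2) / cosh (\<alpha> * x) * (exp (- w\<^sup>2) / cosh (\<alpha> * (x - w) / 2))))"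
    by (simp only: integral_mult_right_zero fourier_gaussian_sech[OF assms] mult.left_commute)
  also have "\<dots> = \<alpha> / (2 * sqrt pi) * (LBINT x. LBINT w. exp (- x\<^sup>2) * exp (- w\<^sup>2) / (cosh (\<alpha> * x) * cosh (\<alpha> * (x - w) / 2)))"
    by simp
  finally show ?thesis
    unfolding double_integral_sech .
qed

lemma integral_even_half_line:
  fixes f :: "real \<Rightarrow> real"
  assumes "integrable lborel f" "\<And>x. f (- x) = f x"
  shows "(LBINT x:{0..}. f x) = integral\<^sup>L lborel f / 2"
proof -
  have "integrable lborel (\<lambda>x. indicator {0..} x *\<^sub>R f x)"
    using assms(1) by (intro integrable_mult_indicator) simp_all
  then have "has_bochner_integral lborel (\<lambda>x. indicator {0..} x *\<^sub>R f x) (LBINT x:{0..}. f x)"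
    by (simp add: has_bochner_integral_iff set_lebesgue_integral_def)
  from has_bochner_integral_even_function[OF this] assms(2) show ?thesis
    by (simp add: has_bochner_integral_iff)
qed

theorem mainTheorem8:
  fixes \<alpha> \<beta> :: real
  assumes "\<alpha> > 0" and "\<beta> > 0" and "\<alpha> * \<beta> = 2 * pi"
  shows "sqrt 2 *
      (LBINT y:{0..}. (LBINT x:{0..}.
         cos (2 * x * y) / (cosh (\<alpha> * x) * cosh (\<beta> * y)) * exp (- x\<^sup>2 - y\<^sup>2)))
    = (LBINT x:{0..}. cosh (\<alpha> * x / 2) / cosh (\<alpha> * x) * exp (- x\<^sup>2))
      * (LBINT y:{0..}. cosh (\<beta> * y / 2) / cosh (\<beta> * y) * exp (- y\<^sup>2))"
proof -
  define f where "f = (\<lambda>x y. cos (2 * x * y) / (cosh (\<alpha> * x) * cosh (\<beta> * y)) * exp (- x\<^sup>2 - y\<^sup>2))"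
  have int: "integrable (lborel \<Otimes>\<^sub>M lborel) (case_prod f)"
    unfolding f_def by (rule integrable_kernel)
  \<comment> \<open>Joint integrability would give this only for almost every \<open>y\<close>; the
    Gaussian bound gives it for every \<open>y\<close>.\<close>
  have intx: "integrable lborel (\<lambda>x. f x y)" for y
  proof (rule Bochner_Integration.integrable_bound[OF integrable_gaussian])
    show "(\<lambda>x. f x y) \<in> borel_measurable lborel"
      unfolding f_def by (simp, intro borel_measurable_continuous_onI continuous_intros) simp
    have "\<bar>f x y\<bar> \<le> exp (- x\<^sup>2)" for x
      unfolding f_def by (rule order_trans[OF kernel_bound]) simp
    then show "AE x in lborel. norm (f x y) \<le> norm (exp (- x\<^sup>2))"
      by simp
  qed
  have even_x: "f (- x) y = f x y" and even_y: "f x (- y) = f x y" for x y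
    by (simp_all add: f_def)
  define L where "L = (LBINT y. LBINT x. f x y)"
  \<comment> \<open>The kernel is even in each variable, so the quadrant carries a quarter of the
    integral over the plane.\<close>
  have half: "(LBINT y:{0..}. LBINT x:{0..}. f x y) = L / 4"
  proof -
    have "(LBINT y:{0..}. LBINT x:{0..}. f x y) = (LBINT y:{0..}. (LBINT x. f x y) / 2)"
      using intx even_x by (simp add: integral_even_half_line)
    also have "\<dots> = (LBINT y. (LBINT x. f x y) / 2) / 2"
      by (intro integral_even_half_line)
         (use lborel_pair.integrable_snd[OF int] in \<open>simp_all add: even_y\<close>)
    finally show ?thesis by (simp add: L_def)
  qed
  define A where "A = cosh_ratio_integral \<alpha>"
  define B where "B = cosh_ratio_integral \<beta>"
  have "L = (LBINT x. LBINT y. f x y)"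
    unfolding L_def by (rule lborel_pair.Fubini_integral[OF int])
  then have LA: "L = \<alpha> / (2 * sqrt pi) * A\<^sup>2"
    using double_integral_eq_square[OF assms] by (simp add: f_def A_def)
  \<comment> \<open>With \<open>y\<close> outermost, \<open>L\<close> is already the same integral
    with the parameters exchanged, so no second use of Fubini is required.\<close>
  have "L = (LBINT y. LBINT x. cos (2 * y * x) / (cosh (\<beta> * y) * cosh (\<alpha> * x)) * exp (- y\<^sup>2 - x\<^sup>2))"
    by (simp add: L_def f_def mult_ac minus_diff_commute)
  then have LB: "L = \<beta> / (2 * sqrt pi) * B\<^sup>2"
    using double_integral_eq_square[OF assms(2,1)] assms(3) by (simp add: B_def mult.commute)
  \<comment> \<open>The two evaluations of \<open>L\<close> are multiplied, which yields the claim
    only for squares; nonnegativity removes the squares.\<close>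
  have pos: "A \<ge> 0" "B \<ge> 0" "L \<ge> 0"
    using assms by (simp_all add: LA) (simp_all add: A_def B_def cosh_ratio_integral_def)
  have "(sqrt 2 * L)\<^sup>2 = 2 * (L * L)"
    by (simp add: power_mult_distrib power2_eq_square)
  also have "L * L = (\<alpha> / (2 * sqrt pi) * A\<^sup>2) * (\<beta> / (2 * sqrt pi) * B\<^sup>2)"
    using LA LB by simp
  also have "\<dots> = (\<alpha> * \<beta>) / (4 * (sqrt pi * sqrt pi)) * (A * B)\<^sup>2"
    by (simp add: power_mult_distrib)
  \<comment> \<open>The constant is \<open>\<alpha> * \<beta> / (4 * pi) = 1 / 2\<close>, which
    cancels the 2.\<close>
  also have "2 * \<dots> = (A * B)\<^sup>2"
    using assms(3) by simp
  finally have "sqrt 2 * L = A * B"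
    using pos by (simp add: power2_eq_iff_nonneg)
  then have main: "sqrt 2 * L = cosh_ratio_integral \<alpha> * cosh_ratio_integral \<beta>"
    by (simp only: A_def B_def)
  have single: "(LBINT x:{0..}. cosh (c * x / 2) / cosh (c * x) * exp (- x\<^sup>2)) = cosh_ratio_integral c / 2" for c
    unfolding cosh_ratio_integral_def by (intro integral_even_half_line cosh_ratio_integrable) simp
  show ?thesis
    unfolding half[unfolded f_def] single using main by simp
qed

end
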